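(* Let $N$ be a positive integer, let $a\in\{1,2,\ldots,N\}$, and let $r$ be a variable. For formal variables $u,v,w$, we have $$\sum_{\substack{k\geq n+s\\ n\geq s\geq 1}}X_0^r(k,n,s)\,u^{k-n-s}v^{n-s}w^{2s-2}=\frac{1}{(a-\alpha_1)(a-\alpha_2)}\;{}_3F_2\!\left({\frac{a+\beta_1}{N},\ \frac{a+\beta_2}{N},\ 1\atop \frac{a-\alpha_1}{N}+1,\ \frac{a-\alpha_2}{N}+1};\,1\right),$$ where $\alpha_1,\alpha_2$ are determined by $\alpha_1+\alpha_2=u+vr$, $\alpha_1\alpha_2=r(uv-w^2)$, and $\beta_1,\beta_2$ are determined by $\beta_1+\beta_2=-u+v(1-r)$, $\beta_1\beta_2=(r-1)(uv-w^2)$.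
   Context: An index is a finite sequence $\mathbf{k}=(k_1,\ldots,k_n)$ of positive integers. Its weight is $k_1+\cdots+k_n$, its depth is $\operatorname{dep}(\mathbf{k})=n$, and its height is the number of $i$ with $k_i\geq 2$. It is admissible if $k_1>1$. For an admissible index define the multiple $t$-value of level $N$ $$t_{N,a}(\mathbf{k})=\sum_{\substack{m_1>\cdots>m_n>0\\ m_i\equiv a \ (\mathrm{mod}\ N)}}\frac{1}{m_1^{k_1}\cdots m_n^{k_n}}$$ and the interpolated multiple $t$-value of level $N$ $$t_{N,a}^r(\mathbf{k})=\sum_{\mathbf{p}}r^{\,n-\operatorname{dep}(\mathbf{p})}\,t_{N,a}(\mathbf{p}),$$ where $\mathbf{p}$ runs over all $2^{n-1}$ indices obtained from $(k_1\,\Box\, k_2\,\Box\cdots\Box\, k_n)$ by replacing each $\Box$ with either a comma or a plus sign (each choice of replacements counted once). $I_0(k,n,s)$ is the set of all admissible indices of weight $k$, depth $n$ and height $s$, and $X_0^r(k,n,s)=\sum_{\mathbf{k}\in I_0(k,n,s)}t_{N,a}^r(\mathbf{k})$. The generalized hypergeometric function is ${}_3F_2\left({b_1,b_2,b_3\atop c_1,c_2};z\right)=\sum_{n=0}^\infty\frac{(b_1)_n(b_2)_n(b_3)_n}{(c_1)_n(c_2)_n}\frac{z^n}{n!}$, with $(b)_0=1$ and $(b)_n=b(b+1)\cdots(b+n-1)$ for $n>0$. Identities in formal variables are identities of formal power series in $u,v,w$. The right-hand side is symmetric in $\alpha_1,\alpha_2$ and in $\beta_1,\beta_2$; each term of the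 series is expanded as a power series in $u,v,w$, and the series is summed coefficientwise. *)

theory Defs
  imports
    "HOL-Analysis.Infinite_Sum"
    "HOL-Number_Theory.Cong"
    "HOL-Computational_Algebra.Computational_Algebra"
    "HOL-Algebra.Algebraic_Closure_Type"
begin

definition is_index :: "nat list \<Rightarrow> bool" where
  "is_index ks \<longleftrightarrow> ks \<noteq> [] \<and> (\<forall>k\<in>set ks. k > 0)"

definition height :: "nat list \<Rightarrow> nat" where
  "height ks = length (filter (\<lambda>k. k \<ge> 2) ks)"

definition admissible :: "nat list \<Rightarrow> bool" where
  "admissible ks \<longleftrightarrow> is_index ks \<and> hd ks > 1"

definition mtv_range :: "nat \<Rightarrow> nat \<Rightarrow> nat \<Rightarrow> nat list set" where
  "mtv_range N a n =
     {ms. length ms = n \<and> sorted_wrt (>) ms \<and> (\<forall>m\<in>set ms. m > 0 \<and> [m = a] (mod N))}"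

definition mtv :: "nat \<Rightarrow> nat \<Rightarrow> nat list \<Rightarrow> real" where
  "mtv N a ks =
     (\<Sum>\<^sub>\<infinity>ms\<in>mtv_range N a (length ks). 1 / prod_list (map2 (\<lambda>m k. real m ^ k) ms ks))"

text \<open>
  One entry per choice of a comma or a plus sign in every box, so the list has
  $2^{n-1}$ entries, of which some may coincide.
\<close>
fun box_choices :: "nat list \<Rightarrow> nat list list" where
  "box_choices [] = [[]]"
| "box_choices [k] = [[k]]"
| "box_choices (k # l # ks) = map ((#) k) (box_choices (l # ks)) @ box_choices ((k + l) # ks)"

text \<open>The interpolated value, as a polynomial in the variable \<open>r\<close>.\<close>
definition interp_mtv :: "nat \<Rightarrow> nat \<Rightarrow> nat list \<Rightarrow> real poly" where
  "interp_mtv N a ks =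
     (\<Sum>p\<leftarrow>box_choices ks. Polynomial.monom (mtv N a p) (length ks - length p))"

definition I0 :: "nat \<Rightarrow> nat \<Rightarrow> nat \<Rightarrow> nat list set" where
  "I0 k n s = {ks. admissible ks \<and> sum_list ks = k \<and> length ks = n \<and> height ks = s}"

definition X0 :: "nat \<Rightarrow> nat \<Rightarrow> nat \<Rightarrow> nat \<Rightarrow> nat \<Rightarrow> real poly" where
  "X0 N a k n s = (\<Sum>ks\<in>I0 k n s. interp_mtv N a ks)"

text \<open>
  The ring $R[r][[u,v,w]]$ over the reals is nested as $R[r][[u]][[v]][[w]]$.
\<close>
type_synonym series = "real poly fps fps fps"

definition ser_r :: series where
  "ser_r = fps_const (fps_const (fps_const [:0, 1:]))"

definition ser_u :: series where
  "ser_u = fps_const (fps_const fps_X)"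

definition ser_v :: series where
  "ser_v = fps_const fps_X"

definition ser_w :: series where
  "ser_w = fps_X"

definition mk_series :: "(nat \<Rightarrow> nat \<Rightarrow> nat \<Rightarrow> real poly) \<Rightarrow> series" where
  "mk_series c = Abs_fps (\<lambda>l. Abs_fps (\<lambda>j. Abs_fps (\<lambda>i. c i j l)))"

text \<open>The coefficient of $u^i v^j w^l$.\<close>
definition ser_coeff :: "series \<Rightarrow> nat \<Rightarrow> nat \<Rightarrow> nat \<Rightarrow> real poly" where
  "ser_coeff F i j l = fps_nth (fps_nth (fps_nth F l) j) i"

text \<open>
  The sum of $X_0^r(k,n,s) u^{k-n-s} v^{n-s} w^{2s-2}$ over all $k \geq n+s$,
  $n \geq s \geq 1$: the coefficient of a monomial collects the triples $(k,n,s)$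
  which contribute to it (at most one).
\<close>
definition X0_series :: "nat \<Rightarrow> nat \<Rightarrow> series" where
  "X0_series N a = mk_series (\<lambda>i j l.
     \<Sum>(k, n, s) \<in> {(k, n, s). k \<ge> n + s \<and> n \<ge> s \<and> s \<ge> 1 \<and>
                       k - n - s = i \<and> n - s = j \<and> 2 * s - 2 = l}. X0 N a k n s)"

text \<open>
  The elements $\alpha_i$ and $\beta_i$ are in general not power series in $u,v,w$; they
  live in an algebraic closure of the field of fractions of the power series ring.
\<close>
type_synonym series_closure = "series fract alg_closure"

definition emb :: "series \<Rightarrow> series_closure" where
  "emb F = to_ac (to_fract F)"

text \<open>These make the library's \<^const>\<open>fps_hypergeo\<close> available over \<^typ>\<open>series_closure\<close>.\<close>
instance fps :: (ring_char_0) ring_char_0 ..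

instance fract :: ("{idom, ring_char_0}") field_char_0
proof
  show "inj (of_nat :: nat \<Rightarrow> 'a fract)"
    by (rule injI) (simp add: of_nat_fract eq_fract)
qed

text \<open>So elements with prescribed sum and product, like $\alpha_1,\alpha_2$, do exist.\<close>
lemma exists_sum_prod:
  fixes s p :: "'a :: alg_closed_field"
  shows "\<exists>x y. x + y = s \<and> x * y = p"
proof -
  have "\<exists>x. poly [:p, -s, 1:] x = 0"
    by (rule alg_closed_imp_poly_has_root) simp
  then obtain x where "poly [:p, -s, 1:] x = 0" ..
  hence "x + (s - x) = s \<and> x * (s - x) = p"
    by (simp add: algebra_simps eq_neg_iff_add_eq_0)
  thus ?thesis by blast
qed

text \<open>
  A series of elements of the closure, each of which is (the image of) a power series in
  $u,v,w$, is summed coefficientwise. The coefficients are polynomials in the variable \<open>r\<close>,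
  which are in turn summed coefficientwise over the reals.
\<close>
definition sums_coeffwise :: "(nat \<Rightarrow> series_closure) \<Rightarrow> series \<Rightarrow> bool" where
  "sums_coeffwise f S \<longleftrightarrow>
     (\<exists>T. (\<forall>n. f n = emb (T n)) \<and>
          (\<forall>i j l d. (\<lambda>n. Polynomial.coeff (ser_coeff (T n) i j l) d)
                        sums Polynomial.coeff (ser_coeff S i j l) d))"

text \<open>
  \<^term>\<open>fps_hypergeo [b1, b2, b3] [c1, c2] c\<close> is the generalized hypergeometric series in
  \<open>c * z\<close> for a formal \<open>z\<close>, so its \<open>n\<close>-th coefficient is the \<open>n\<close>-th term of the
  hypergeometric series at argument \<open>c\<close>.
\<close>
definition has_3F2_value ::
  "series_closure \<Rightarrow> series_closure \<Rightarrow> series_closure \<Rightarrow> series_closure \<Rightarrow> series_closure \<Rightarrow>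
   series_closure \<Rightarrow> series \<Rightarrow> bool" where
  "has_3F2_value b1 b2 b3 c1 c2 z H \<longleftrightarrow>
     sums_coeffwise (fps_nth (fps_hypergeo [b1, b2, b3] [c1, c2] z)) H"

end

theory Submission
  imports Defs "HOL-Analysis.Summation_Tests"
begin

text \<open>
  Let $m_j = a + jN$. The interpolated value is a sum over weakly decreasing sequences of the
  $m_j$, in which every equality contributes a factor $r$. Summed over all indices, an entry
  carried by $m$ contributes $g = v/m + w^2/(m(m-u))$ (entries 1 and entries $\geq 2$), so a
  block of entries carried by the same $m$ contributes $g/(1-rg)$. With
  $Q(m) = (m-\alpha_1)(m-\alpha_2)$ and $P(m) = (m+\beta_1)(m+\beta_2)$ one has
  $1-rg = Q(m)/(m(m-u))$ and $1 + g/(1-rg) = P(m)/Q(m)$. Hence the admissible indices, with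
  largest summation variable $m_J$, contribute $S_J = Q(m_J)^{-1} \prod_{j<J} P(m_j)/Q(m_j)$,
  which is the $J$-th hypergeometric term divided by $Q(a)$. Inverses of
  power series are avoided by working with $Q(m_0) S_0 = 1$ and
  $Q(m_{J+1}) S_{J+1} = P(m_J) S_J$.
\<close>

subsection \<open>Interpolated sums with fixed largest variable\<close>

text \<open>The multiple t-value truncated to summation variables below \<open>m J\<close>, for
  increasing \<open>m\<close>; the outermost \<open>j\<close> carries the first entry.\<close>

fun strict_sum :: "(nat \<Rightarrow> nat) \<Rightarrow> nat list \<Rightarrow> nat \<Rightarrow> real" where
  "strict_sum m [] J = 1"
| "strict_sum m (k # ks) J = (\<Sum>j<J. strict_sum m ks j / real (m j) ^ k)"

text \<open>The part of the t-value of a nonempty \<open>p\<close> whose largest variable is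
  \<open>m J\<close>.\<close>

definition head_sum :: "(nat \<Rightarrow> nat) \<Rightarrow> nat list \<Rightarrow> nat \<Rightarrow> real" where
  "head_sum m p J = strict_sum m (tl p) J / real (m J) ^ hd p"

definition interp_head :: "(nat \<Rightarrow> nat) \<Rightarrow> nat list \<Rightarrow> nat \<Rightarrow> real poly" where
  "interp_head m ks J =
     (\<Sum>p\<leftarrow>box_choices ks. Polynomial.monom (head_sum m p J) (length ks - length p))"

text \<open>What may follow an entry carried by \<open>m J\<close>: the next entry has a strictly
  smaller variable, or the same one at the price of a factor r, which is \<open>pCons 0\<close>. The
  empty list ends the index and contributes 1.\<close>

definition interp_tail :: "(nat \<Rightarrow> nat) \<Rightarrow> nat list \<Rightarrow> nat \<Rightarrow> real poly" where
  "interp_tail m ks J =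
     (if ks = [] then 1 else (\<Sum>j<J. interp_head m ks j) + pCons 0 (interp_head m ks J))"

lemma strict_sum_eq_sum_head:
  "p \<noteq> [] \<Longrightarrow> strict_sum m p J = (\<Sum>j<J. head_sum m p j)"
  by (cases p) (auto simp: head_sum_def)

lemma box_choices_length:
  assumes "ks \<noteq> []" "p \<in> set (box_choices ks)"
  shows   "p \<noteq> [] \<and> length p \<le> length ks"
  using assms
proof (induction ks arbitrary: p rule: box_choices.induct)
  case (3 k l ks)
  from "3.prems" consider q where "p = k # q" "q \<in> set (box_choices (l # ks))" |
    "p \<in> set (box_choices ((k + l) # ks))" by auto
  thus ?case
  proof cases
    case (1 q)
    thus ?thesis using "3.IH"(1)[of q] by simp
  next
    case 2
    thus ?thesis using "3.IH"(2)[of p] by simp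
  qed
qed simp_all

text \<open>Merging only enlarges the first entry, so a head above 1, which convergence requires,
  survives every choice.\<close>

lemma box_choices_hd_ge:
  assumes "ks \<noteq> []" "p \<in> set (box_choices ks)"
  shows   "hd ks \<le> hd p"
  using assms
proof (induction ks arbitrary: p rule: box_choices.induct)
  case (3 k l ks)
  have "p \<in> (#) k ` set (box_choices (l # ks)) \<or> p \<in> set (box_choices ((k + l) # ks))"
    using "3.prems" by simp
  thus ?case using "3.IH"(2)[of p] by fastforce
qed simp_all

lemma box_choices_pos:
  assumes "0 \<notin> set ks" "p \<in> set (box_choices ks)"
  shows   "0 \<notin> set p"
  using assms
proof (induction ks arbitrary: p rule: box_choices.induct)
  case (3 k l ks)
  from "3.prems" consider q where "p = k # q" "q \<in> set (box_choices (l # ks))" |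
    "p \<in> set (box_choices ((k + l) # ks))" by auto
  thus ?case
  proof cases
    case (1 q)
    thus ?thesis using "3.IH"(1)[of q] "3.prems" by simp
  next
    case 2
    thus ?thesis using "3.IH"(2)[of p] "3.prems" by simp
  qed
qed simp_all

text \<open>The first entry enters a choice only as a summand of its head, so the extra
  \<open>k\<close> can be added before or after the choices are made.\<close>

lemma box_choices_add_hd:
  "box_choices ((k + l) # ks) = map (\<lambda>p. (k + hd p) # tl p) (box_choices (l # ks))"
proof (induction ks arbitrary: l)
  case (Cons h ks)
  show ?case using Cons[of "l + h"] by (simp add: add.assoc)
qed auto

lemma sum_list_smult: "(\<Sum>x\<leftarrow>xs. smult c (f x)) = smult c (\<Sum>x\<leftarrow>xs. f x)"
  by (induction xs) (auto simp: smult_add_right)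

lemma sum_list_sum:
  "(\<Sum>x\<leftarrow>xs. \<Sum>j\<in>A. f x j) = (\<Sum>j\<in>A. \<Sum>x\<leftarrow>xs. f x j)"
  for f :: "'a \<Rightarrow> 'b \<Rightarrow> 'c :: comm_monoid_add"
  by (induction xs) (auto simp: sum.distrib)

lemma sum_list_pCons0: "(\<Sum>x\<leftarrow>xs. pCons 0 (f x)) = pCons 0 (\<Sum>x\<leftarrow>xs. f x)"
  by (induction xs) auto

text \<open>Split by the first box. A comma leaves a sum over strictly smaller variables; a plus
  sign keeps \<open>m J\<close> and shortens the index by one, which costs a factor r. This turns
  the interpolation into a recursion along the list.\<close>

lemma interp_head_Cons:
  "interp_head m (k # ks) J = smult (1 / real (m J) ^ k) (interp_tail m ks J)"
proof (cases ks)
  case Nil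
  thus ?thesis
    by (simp add: interp_head_def interp_tail_def head_sum_def smult_monom flip: monom_0)
next
  case (Cons l ls)
  define c where "c = 1 / real (m J) ^ k"
  have "(\<Sum>p\<leftarrow>box_choices (l # ls).
           Polynomial.monom (head_sum m (k # p) J) (length (k # l # ls) - length (k # p))) =
        (\<Sum>p\<leftarrow>box_choices (l # ls). smult c (\<Sum>j<J.
           Polynomial.monom (head_sum m p j) (length (l # ls) - length p)))"
  proof (intro arg_cong[where f = sum_list] map_cong refl)
    fix p assume "p \<in> set (box_choices (l # ls))"
    hence "p \<noteq> []" using box_choices_length[of "l # ls" p] by auto
    hence "head_sum m (k # p) J = c * (\<Sum>j<J. head_sum m p j)"
      by (simp add: head_sum_def[of m "k # p"] strict_sum_eq_sum_head c_def)
    thus "Polynomial.monom (head_sum m (k # p) J) (length (k # l # ls) - length (k # p)) =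
            smult c (\<Sum>j<J. Polynomial.monom (head_sum m p j) (length (l # ls) - length p))"
      by (simp add: poly_eq_iff coeff_sum)
  qed
  also have "\<dots> = smult c (\<Sum>j<J. interp_head m (l # ls) j)"
    by (simp add: sum_list_smult sum_list_sum interp_head_def)
  finally have 1: "(\<Sum>p\<leftarrow>box_choices (l # ls).
      Polynomial.monom (head_sum m (k # p) J) (length (k # l # ls) - length (k # p))) = \<dots>" .
  have "(\<Sum>p\<leftarrow>box_choices ((k + l) # ls).
           Polynomial.monom (head_sum m p J) (length (k # l # ls) - length p)) =
        (\<Sum>p\<leftarrow>box_choices (l # ls). smult c (pCons 0
           (Polynomial.monom (head_sum m p J) (length (l # ls) - length p))))"
    unfolding box_choices_add_hd map_map
  proof (intro arg_cong[where f = sum_list] map_cong refl)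
    fix p assume "p \<in> set (box_choices (l # ls))"
    hence p: "p \<noteq> []" "length p \<le> length (l # ls)" using box_choices_length[of "l # ls" p] by auto
    have "head_sum m ((k + hd p) # tl p) J = c * head_sum m p J"
      by (simp add: head_sum_def c_def power_add)
    \<comment> \<open>One merge raises the exponent of r by one; the bound on
      \<open>length p\<close> keeps the truncated subtraction exact.\<close>
    moreover have "length (k # l # ls) - length ((k + hd p) # tl p) = 
        Suc (length (l # ls) - length p)"
      using p by (cases p) auto
    ultimately show "((\<lambda>p. Polynomial.monom (head_sum m p J) (length (k # l # ls) - length p)) \<circ>
           (\<lambda>p. (k + hd p) # tl p)) p =
         smult c (pCons 0 (Polynomial.monom (head_sum m p J) (length (l # ls) - length p)))"
      by (simp only: o_def monom_Suc flip: smult_monom) simp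
  qed
  also have "\<dots> = smult c (pCons 0 (interp_head m (l # ls) J))"
    by (simp only: sum_list_smult sum_list_pCons0 interp_head_def)
  finally have 2: "(\<Sum>p\<leftarrow>box_choices ((k + l) # ls).
      Polynomial.monom (head_sum m p J) (length (k # l # ls) - length p)) = \<dots>" .
  have "interp_head m (k # ks) J =
      (\<Sum>p\<leftarrow>box_choices (l # ls).
         Polynomial.monom (head_sum m (k # p) J) (length (k # l # ls) - length (k # p))) +
      (\<Sum>p\<leftarrow>box_choices ((k + l) # ls).
         Polynomial.monom (head_sum m p J) (length (k # l # ls) - length p))"
    by (simp add: Cons interp_head_def o_def)
  also have "\<dots> = smult c (interp_tail m ks J)"
    unfolding 1 2 by (simp add: interp_tail_def Cons smult_add_right)
  finally show ?thesis by (simp add: c_def)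
qed

section \<open>Recursive decomposition of the sets of index lists\<close>

text \<open>
  Indices contributing to $u^i v^j w^{2h}$: there are \<open>j\<close> entries 1 and \<open>h\<close> entries $\geq 2$, and
  the latter exceed 2 by \<open>i\<close> in total.
\<close>
definition positive_lists :: "nat \<Rightarrow> nat \<Rightarrow> nat \<Rightarrow> nat list set" where
  "positive_lists i j h = {ks. 0 \<notin> set ks \<and> sum_list ks = i + j + 2 * h \<and>
                           length ks = j + h \<and> height ks = h}"

definition admissible_lists :: "nat \<Rightarrow> nat \<Rightarrow> nat \<Rightarrow> nat list set" where
  "admissible_lists i j h = {ks \<in> positive_lists i j h. ks \<noteq> [] \<and> hd ks > 1}"

text \<open>Solving \<open>k - n - s = i\<close> and \<open>n - s = j\<close> for
  \<open>s = h\<close> gives these values of weight and depth.\<close>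

lemma admissible_lists_eq_I0: "admissible_lists i j h = I0 (i + j + 2 * h) (j + h) h"
proof -
  have "(\<forall>k\<in>set ks. k > 0) \<longleftrightarrow> 0 \<notin> set ks" for ks :: "nat list"
    by (induction ks) auto
  thus ?thesis
    by (auto simp: admissible_lists_def positive_lists_def I0_def admissible_def is_index_def)
qed

lemma finite_positive_lists: "finite (positive_lists i j h)"
proof (rule finite_subset)
  show "positive_lists i j h \<subseteq> {ks. set ks \<subseteq> {..i + j + 2 * h} \<and> length ks = j + h}"
  proof (intro subsetI CollectI conjI)
    fix ks x assume ks: "ks \<in> positive_lists i j h"
    show "length ks = j + h" using ks by (simp add: positive_lists_def)
    fix k assume "k \<in> set ks"
    thus "k \<in> {..i + j + 2 * h}"
      using ks member_le_sum_list[of k ks] by (simp add: positive_lists_def)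
  qed
qed (auto intro: finite_lists_length_eq)

lemma finite_admissible_lists: "finite (admissible_lists i j h)"
  by (simp add: admissible_lists_def finite_positive_lists)

lemma height_Nil [simp]: "height [] = 0"
  and height_Cons [simp]: "height (k # ks) = (if k \<ge> 2 then Suc (height ks) else height ks)"
  by (auto simp: height_def)

lemma height_le_length: "height ks \<le> length ks"
  by (auto simp: height_def)

text \<open>An entry 1 counts once on the left, a larger entry twice, which is at most its size. For
  \<open>positive_lists i j h\<close> the slack is \<open>i\<close>, the exponent of u.\<close>

lemma length_add_height_le: "0 \<notin> set ks \<Longrightarrow> length ks + height ks \<le> sum_list ks"
  by (induction ks) auto

text \<open>Split by the head: none, 1, or at least 2. Dropping a head 1 lowers only
  \<open>j\<close>, the exponent of v.\<close>

lemma positive_lists_rec: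
  "positive_lists i j h =
     (if i = 0 \<and> j = 0 \<and> h = 0 then {[]} else {}) \<union>
     ((if j = 0 then {} else (#) 1 ` positive_lists i (j - 1) h) \<union> admissible_lists i j h)"
  (is "_ = ?R")
proof (intro Set.set_eqI iffI)
  fix ks assume *: "ks \<in> positive_lists i j h"
  consider "ks = []" | "ks \<noteq> []" "hd ks > 1" | l where "ks = 1 # l"
  proof (cases ks)
    case (Cons k l)
    have "k = 1 \<or> k > 1" using * Cons by (cases k) (auto simp: positive_lists_def)
    thus ?thesis using Cons that by auto
  qed (use that in auto)
  thus "ks \<in> ?R"
  proof cases
    case (3 l)
    \<comment> \<open>The tail keeps height \<open>h\<close> but has one entry fewer than
      \<open>j + h\<close>, so \<open>j = 0\<close> would make it shorter than its height.\<close>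
    have "j \<noteq> 0" using * height_le_length[of l] by (auto simp: 3 positive_lists_def)
    thus ?thesis using * by (auto simp: 3 positive_lists_def)
  qed (use * in \<open>auto simp: positive_lists_def admissible_lists_def\<close>)
qed (auto simp: positive_lists_def admissible_lists_def split: if_splits)

definition inc_hd :: "nat list \<Rightarrow> nat list" where
  "inc_hd ks = Suc (hd ks) # tl ks"

text \<open>A head 2 is dropped, leaving an arbitrary positive list; a larger head is lowered by
  one, which lowers only \<open>i\<close>. Iterating the second case expands the geometric series of
  1/(m(m-u)) in u.\<close>

lemma admissible_lists_rec:
  "admissible_lists i j (Suc h) =
     (#) 2 ` positive_lists i j h \<union>
     (if i = 0 then {} else inc_hd ` admissible_lists (i - 1) j (Suc h))"
  (is "_ = ?R")
proof (intro Set.set_eqI iffI)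
  fix ks assume *: "ks \<in> admissible_lists i j (Suc h)"
  then obtain k l where ks: "ks = k # l" "k > 1"
    by (cases ks) (auto simp: admissible_lists_def)
  show "ks \<in> ?R"
  proof (cases "k = 2")
    case True
    thus ?thesis using * ks by (auto simp: admissible_lists_def positive_lists_def)
  next
    case False
    hence "k > 2" using ks by auto
    \<comment> \<open>A head above 2 exceeds its contribution to length plus height, so the slack
      \<open>i\<close> is positive.\<close>
    have "i \<noteq> 0"
      using * \<open>k > 2\<close> length_add_height_le[of l]
      by (auto simp: ks admissible_lists_def positive_lists_def)
    moreover have "ks = inc_hd ((k - 1) # l)" using \<open>k > 2\<close> by (simp add: inc_hd_def ks)
    moreover have "(k - 1) # l \<in> admissible_lists (i - 1) j (Suc h)"
      using * \<open>k > 2\<close> \<open>i \<noteq> 0\<close> by (auto simp: ks admissible_lists_def positive_lists_def)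
    ultimately show ?thesis by auto
  qed
next
  fix ks assume "ks \<in> ?R"
  thus "ks \<in> admissible_lists i j (Suc h)"
  proof
    assume "ks \<in> (#) 2 ` positive_lists i j h"
    thus ?thesis by (auto simp: admissible_lists_def positive_lists_def)
  next
    assume "ks \<in> (if i = 0 then {} else inc_hd ` admissible_lists (i - 1) j (Suc h))"
    then obtain l where l: "i \<noteq> 0" "l \<in> admissible_lists (i - 1) j (Suc h)" "ks = inc_hd l"
      by (auto split: if_splits)
    thus ?thesis
      by (cases l) (auto simp: admissible_lists_def positive_lists_def inc_hd_def)
  qed
qed

lemma sum_positive_lists:
  "(\<Sum>ks\<in>positive_lists i j h. f ks) =
     (if i = 0 \<and> j = 0 \<and> h = 0 then f [] else 0) +
     (if j = 0 then 0 else (\<Sum>ks\<in>positive_lists i (j - 1) h. f (1 # ks))) +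
     (\<Sum>ks\<in>admissible_lists i j h. f ks)"
proof -
  define A where "A = (if i = 0 \<and> j = 0 \<and> h = 0 then {[] :: nat list} else {})"
  define B where "B = (if j = 0 then {} else (#) 1 ` positive_lists i (j - 1) h)"
  have "sum f (positive_lists i j h) = sum f A + (sum f B + sum f (admissible_lists i j h))"
    unfolding positive_lists_rec[of i j h] A_def[symmetric] B_def[symmetric]
    by (subst sum.union_disjoint; (subst sum.union_disjoint)?)
       (auto simp: A_def B_def finite_positive_lists finite_admissible_lists admissible_lists_def)
  moreover have "sum f B = (if j = 0 then 0 else (\<Sum>ks\<in>positive_lists i (j - 1) h. f (1 # ks)))"
    by (auto simp: B_def sum.reindex)
  ultimately show ?thesis by (simp add: A_def)
qed

lemma inj_on_inc_hd: "inj_on inc_hd (admissible_lists i j h)"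
  by (rule inj_onI) (auto simp: inc_hd_def admissible_lists_def intro: list.expand)

lemma sum_admissible_lists:
  "(\<Sum>ks\<in>admissible_lists i j (Suc h). f ks) =
     (\<Sum>ks\<in>positive_lists i j h. f (2 # ks)) +
     (if i = 0 then 0 else (\<Sum>ks\<in>admissible_lists (i - 1) j (Suc h). f (inc_hd ks)))"
proof -
  define B where "B = (if i = 0 then {} else inc_hd ` admissible_lists (i - 1) j (Suc h))"
  have "sum f (admissible_lists i j (Suc h)) = sum f ((#) 2 ` positive_lists i j h) + sum f B"
    unfolding admissible_lists_rec[of i j h] B_def[symmetric]
    by (subst sum.union_disjoint)
       (auto simp: B_def finite_positive_lists finite_admissible_lists admissible_lists_def
          inc_hd_def)
  also have "sum f B =
      (if i = 0 then 0 else (\<Sum>ks\<in>admissible_lists (i - 1) j (Suc h). f (inc_hd ks)))"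
    by (auto simp: B_def sum.reindex[OF inj_on_inc_hd])
  finally show ?thesis by (simp add: sum.reindex)
qed

subsection \<open>Generating series of index lists\<close>

lemma series_eqI: "(\<And>i j l. ser_coeff F i j l = ser_coeff G i j l) \<Longrightarrow> F = G"
  by (auto simp: ser_coeff_def fps_eq_iff)

lemma ser_coeff_mk_series [simp]: "ser_coeff (mk_series c) i j l = c i j l"
  by (simp add: ser_coeff_def mk_series_def)

lemma ser_coeff_0 [simp]: "ser_coeff 0 i j l = 0"
  by (simp add: ser_coeff_def)

lemma ser_coeff_1 [simp]: "ser_coeff 1 i j l = (if i = 0 \<and> j = 0 \<and> l = 0 then 1 else 0)"
  by (simp add: ser_coeff_def fps_one_nth)

lemma ser_coeff_add [simp]: "ser_coeff (F + G) i j l = ser_coeff F i j l + ser_coeff G i j l"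
  by (simp add: ser_coeff_def)

lemma ser_coeff_mult:
  "ser_coeff (F * G) i j l =
     (\<Sum>z\<le>l. \<Sum>y\<le>j. \<Sum>x\<le>i. ser_coeff F x y z * ser_coeff G (i - x) (j - y) (l - z))"
  by (simp add: ser_coeff_def fps_mult_nth fps_sum_nth atLeast0AtMost)

lemma ser_coeff_of_nat_mult [simp]: "ser_coeff (of_nat n * F) i j l = of_nat n * ser_coeff F i j l"
  by (induction n) (simp_all add: algebra_simps)

lemma ser_coeff_r_mult [simp]: "ser_coeff (ser_r * F) i j l = pCons 0 (ser_coeff F i j l)"
  by (simp add: ser_coeff_def ser_r_def)

lemma ser_coeff_u_mult [simp]:
  "ser_coeff (ser_u * F) i j l = (if i = 0 then 0 else ser_coeff F (i - 1) j l)"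
  by (simp add: ser_coeff_def ser_u_def)

lemma ser_coeff_v_mult [simp]:
  "ser_coeff (ser_v * F) i j l = (if j = 0 then 0 else ser_coeff F i (j - 1) l)"
  by (simp add: ser_coeff_def ser_v_def)

lemma ser_coeff_w2_mult [simp]:
  "ser_coeff (ser_w ^ 2 * F) i j l = (if l < 2 then 0 else ser_coeff F i j (l - 2))"
  by (simp add: ser_coeff_def ser_w_def fps_X_power_mult_nth)

text \<open>Only even powers of w occur: \<open>l div 2\<close> is the number of entries at least
  2.\<close>

definition list_series :: "(nat list \<Rightarrow> real poly) \<Rightarrow> series" where
  "list_series f = mk_series (\<lambda>i j l. if even l then \<Sum>ks\<in>positive_lists i j (l div 2). f ks else 0)"

text \<open>The \<open>Suc\<close> divides out a factor w^2, in accordance with the exponent 2s-2;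
  by \<open>admissible_lists_0\<close> this loses no list.\<close>

definition admissible_series :: "(nat list \<Rightarrow> real poly) \<Rightarrow> series" where
  "admissible_series f =
     mk_series (\<lambda>i j l. if even l then \<Sum>ks\<in>admissible_lists i j (Suc (l div 2)). f ks else 0)"

lemma list_series_add: "list_series (\<lambda>ks. f ks + g ks) = list_series f + list_series g"
  by (rule series_eqI) (simp add: list_series_def sum.distrib)

lemma list_series_sum: "list_series (\<lambda>ks. \<Sum>x\<in>A. f x ks) = (\<Sum>x\<in>A. list_series (f x))"
proof (induction A rule: infinite_finite_induct)
  case empty
  show ?case by (rule series_eqI) (simp add: list_series_def)
next
  case infinite
  thus ?case by (intro series_eqI) (simp add: list_series_def)
qed (simp_all add: list_series_add)

lemma sum_pCons0: "(\<Sum>x\<in>A. pCons 0 (f x)) = pCons 0 (\<Sum>x\<in>A. f x)"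
  by (induction A rule: infinite_finite_induct) auto

lemma list_series_pCons0: "list_series (\<lambda>ks. pCons 0 (f ks)) = ser_r * list_series f"
  by (rule series_eqI) (simp add: list_series_def sum_pCons0)

lemma list_series_of_nat_mult: "list_series (\<lambda>ks. of_nat n * f ks) = of_nat n * list_series f"
  by (rule series_eqI) (simp add: list_series_def sum_distrib_left)

lemma admissible_series_of_nat_mult:
  "admissible_series (\<lambda>ks. of_nat n * f ks) = of_nat n * admissible_series f"
  by (rule series_eqI) (simp add: admissible_series_def sum_distrib_left)

lemma list_series_Nil: "list_series (\<lambda>ks. if ks = [] then 1 else 0) = 1"
proof (rule series_eqI)
  fix i j l :: nat
  have "[] \<in> positive_lists i j h \<longleftrightarrow> i = 0 \<and> j = 0 \<and> h = 0" for h
    by (auto simp: positive_lists_def)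
  moreover have "l div 2 = 0 \<longleftrightarrow> l = 0" if "even l"
    using that by auto
  ultimately show "ser_coeff (list_series (\<lambda>ks. if ks = [] then 1 else 0)) i j l = ser_coeff 1 i j l"
    by (cases "even l") (auto simp: list_series_def finite_positive_lists)
qed

lemma admissible_lists_0: "admissible_lists i j 0 = {}"
proof -
  have "height ks > 0" if "ks \<noteq> []" "hd ks > 1" for ks
    using that by (cases ks) auto
  thus ?thesis by (force simp: admissible_lists_def positive_lists_def)
qed

text \<open>The head split on generating series: a head 1 yields v, the other nonempty lists yield
  w^2 times the shifted series. The assumption removes the empty list.\<close>

lemma list_series_rec:
  assumes "f [] = 0"
  shows   "list_series f =
             ser_v * list_series (\<lambda>ks. f (1 # ks)) + ser_w ^ 2 * admissible_series f"
proof (rule series_eqI)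
  fix i j l
  show "ser_coeff (list_series f) i j l =
      ser_coeff (ser_v * list_series (\<lambda>ks. f (1 # ks)) + ser_w ^ 2 * admissible_series f) i j l"
  proof (cases "even l")
    case True
    then obtain h where h: "l = 2 * h" by (elim evenE)
    have "(\<Sum>ks\<in>admissible_lists i j h. f ks) = ser_coeff (ser_w ^ 2 * admissible_series f) i j l"
      by (cases h) (simp_all add: h admissible_lists_0 admissible_series_def)
    thus ?thesis
      using assms sum_positive_lists[of f i j h] by (simp add: h list_series_def)
  next
    case False
    thus ?thesis by (simp add: list_series_def admissible_series_def)
  qed
qed

lemma admissible_series_rec:
  "admissible_series f =
     list_series (\<lambda>ks. f (2 # ks)) + ser_u * admissible_series (\<lambda>ks. f (inc_hd ks))"
proof (rule series_eqI)
  fix i j l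
  show "ser_coeff (admissible_series f) i j l = ser_coeff (list_series (\<lambda>ks. f (2 # ks)) +
      ser_u * admissible_series (\<lambda>ks. f (inc_hd ks))) i j l"
    using sum_admissible_lists[of f i j "l div 2"]
    by (simp add: list_series_def admissible_series_def)
qed

text \<open>This is Q(n), written through the sum and product of \<alpha>1 and \<alpha>2 so that it
  lies in the power series ring; \<open>beta_poly\<close> is P(n) likewise.\<close>

definition alpha_poly :: "nat \<Rightarrow> series" where
  "alpha_poly n = of_nat n ^ 2 - of_nat n * (ser_u + ser_v * ser_r) +
                  ser_r * (ser_u * ser_v - ser_w ^ 2)"

definition beta_poly :: "nat \<Rightarrow> series" where
  "beta_poly n = of_nat n ^ 2 + of_nat n * (- ser_u + ser_v * (1 - ser_r)) +
                 (ser_r - 1) * (ser_u * ser_v - ser_w ^ 2)"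

section \<open>The recurrence between successive largest variables\<close>

context
  fixes m :: "nat \<Rightarrow> nat"
  assumes m_pos: "\<And>j. m j > 0"
begin

text \<open>Since \<^term>\<open>box_choices []\<close> is nonempty, the empty list has to be excluded by hand.\<close>
definition head_series :: "nat \<Rightarrow> series" where
  "head_series J = list_series (\<lambda>ks. if ks = [] then 0 else interp_head m ks J)"

definition tail_series :: "nat \<Rightarrow> series" where
  "tail_series J = list_series (\<lambda>ks. interp_tail m ks J)"

text \<open>This is S_J.\<close>

definition admissible_head_series :: "nat \<Rightarrow> series" where
  "admissible_head_series J = admissible_series (\<lambda>ks. interp_head m ks J)"

definition partial_series :: "nat \<Rightarrow> series" where
  "partial_series J = 1 + (\<Sum>j<J. head_series j)"

lemma tail_series_eq: "tail_series J = partial_series J + ser_r * head_series J"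
proof -
  have "(\<lambda>ks. interp_tail m ks J) = (\<lambda>ks. (if ks = [] then 1 else 0) +
      (\<Sum>j<J. if ks = [] then 0 else interp_head m ks j) +
      pCons 0 (if ks = [] then 0 else interp_head m ks J))"
    by (auto simp: interp_tail_def fun_eq_iff)
  thus ?thesis
    by (simp add: tail_series_def partial_series_def head_series_def list_series_add
        list_series_sum list_series_pCons0 list_series_Nil)
qed

text \<open>The denominators are real constants, so they are cleared by multiplying with integers
  and no series has to be inverted.\<close>

lemma of_nat_mult_smult_inverse:
  "of_nat (m J) ^ k * smult (1 / real (m J) ^ k) p = p"
proof -
  define c where "c = real (m J ^ k)"
  have "c \<noteq> 0" using m_pos[of J] by (simp add: c_def)
  moreover have "of_nat (m J) ^ k = [:c:]" unfolding c_def of_nat_power[symmetric] by (rule of_nat_poly)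
  moreover have "real (m J) ^ k = c" by (simp add: c_def)
  ultimately show ?thesis by simp
qed

text \<open>The head split applied after multiplying by \<open>m J\<close>: for a head 1 this factor
  cancels and the free tail remains.\<close>

lemma head_series_eq:
  "of_nat (m J) * head_series J =
     ser_v * tail_series J + ser_w ^ 2 * (of_nat (m J) * admissible_head_series J)"
proof -
  have "of_nat (m J) * head_series J =
      list_series (\<lambda>ks. of_nat (m J) * (if ks = [] then 0 else interp_head m ks J))"
    by (simp add: head_series_def list_series_of_nat_mult)
  also have "\<dots> = ser_v * tail_series J + ser_w ^ 2 *
      admissible_series (\<lambda>ks. of_nat (m J) * (if ks = [] then 0 else interp_head m ks J))"
    using of_nat_mult_smult_inverse[of J 1]
    by (subst list_series_rec) (simp_all add: interp_head_Cons tail_series_def)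
  also have "admissible_series (\<lambda>ks. of_nat (m J) * (if ks = [] then 0 else interp_head m ks J)) =
      of_nat (m J) * admissible_head_series J"
    unfolding admissible_head_series_def admissible_series_of_nat_mult[symmetric]
    by (auto simp: admissible_series_def admissible_lists_def fun_eq_iff
             intro!: arg_cong[where f = mk_series] sum.cong)
  finally show ?thesis .
qed

text \<open>The square of \<open>m J\<close> cancels a head 2; against a head raised by one it
  leaves one factor \<open>m J\<close> with the original head. This is S_J = T/(m(m-u)) without
  division, T being \<open>tail_series J\<close>.\<close>

lemma admissible_head_series_eq:
  "of_nat (m J) ^ 2 * admissible_head_series J =
     tail_series J + ser_u * (of_nat (m J) * admissible_head_series J)"
proof -
  define x :: "real poly" where "x = of_nat (m J)"
  have "x ^ 2 * interp_head m (2 # ks) J = interp_tail m ks J" for ks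
    using of_nat_mult_smult_inverse[of J 2] by (simp add: interp_head_Cons x_def)
  moreover have "x ^ 2 * interp_head m (inc_hd ks) J = x * interp_head m ks J" if "ks \<noteq> []" for ks
  proof (cases ks)
    case (Cons k l)
    have "of_nat (m J) * smult (1 / real (m J) ^ Suc k) p = smult (1 / real (m J) ^ k) p" for p
      using m_pos[of J] by (simp add: of_nat_poly)
    thus ?thesis
      by (simp only: x_def power2_eq_square mult.assoc Cons inc_hd_def interp_head_Cons list.sel)
  qed (use that in auto)
  ultimately have "admissible_series (\<lambda>ks. of_nat (m J ^ 2) * interp_head m ks J) =
      tail_series J + ser_u * admissible_series (\<lambda>ks. of_nat (m J) * interp_head m ks J)"
    by (subst admissible_series_rec)
       (auto simp: tail_series_def x_def admissible_series_def admissible_lists_def fun_eq_iff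
             intro!: arg_cong[where f = mk_series] sum.cong arg_cong2[where f = "(+)"]
                     arg_cong2[where f = "(*)"])
  thus ?thesis
    unfolding admissible_head_series_def admissible_series_of_nat_mult by simp
qed

lemma of_nat_m_nonzero: "of_nat (m J) \<noteq> (0 :: series)"
  using m_pos[of J] by simp

lemma tail_series_eq':
  "tail_series J = (of_nat (m J) ^ 2 - ser_u * of_nat (m J)) * admissible_head_series J"
  using admissible_head_series_eq[of J] by (simp add: algebra_simps)

text \<open>Substitute T = m(m-u) S_J and cancel m; the result is g T.\<close>

lemma head_series_eq':
  "head_series J =
     (ser_v * (of_nat (m J) - ser_u) + ser_w ^ 2) * admissible_head_series J"
proof -
  have "of_nat (m J) * head_series J =
      of_nat (m J) * ((ser_v * (of_nat (m J) - ser_u) + ser_w ^ 2) * admissible_head_series J)"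
    unfolding head_series_eq tail_series_eq'
    by (simp add: algebra_simps power2_eq_square)
  thus ?thesis using mult_left_cancel[OF of_nat_m_nonzero] by blast
qed

text \<open>\<open>partial_series J\<close> is T - r g T, and (1 - r g) m(m-u) = Q(m).\<close>

lemma alpha_poly_mult_head:
  "alpha_poly (m J) * admissible_head_series J = partial_series J"
proof -
  have "partial_series J = tail_series J - ser_r * head_series J"
    by (simp add: tail_series_eq)
  also have "\<dots> = alpha_poly (m J) * admissible_head_series J"
    unfolding head_series_eq' tail_series_eq' alpha_poly_def by (simp add: algebra_simps)
  finally show ?thesis ..
qed

text \<open>Including the lists with largest variable \<open>m J\<close> adds v(m-u) + w^2 to Q(m),
  which gives P(m).\<close>

lemma partial_series_Suc:
  "partial_series (Suc J) = beta_poly (m J) * admissible_head_series J"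
proof -
  have "partial_series (Suc J) = partial_series J + head_series J"
    by (simp add: partial_series_def)
  also have "\<dots> = beta_poly (m J) * admissible_head_series J"
    unfolding head_series_eq' alpha_poly_mult_head[symmetric] alpha_poly_def beta_poly_def
    by (simp add: algebra_simps)
  finally show ?thesis .
qed

lemma admissible_head_series_0: "alpha_poly (m 0) * admissible_head_series 0 = 1"
  by (simp add: alpha_poly_mult_head partial_series_def)

lemma admissible_head_series_Suc:
  "alpha_poly (m (Suc J)) * admissible_head_series (Suc J) =
     beta_poly (m J) * admissible_head_series J"
  by (simp add: alpha_poly_mult_head partial_series_Suc)

end

subsection \<open>Convergence\<close>

lemma strict_sum_nonneg: "strict_sum m ks J \<ge> 0"
  by (induction ks arbitrary: J) (auto intro!: sum_nonneg)

text \<open>Each summand is at most 2(sqrt(j+1) - sqrt(j)), so the bound telescopes.\<close>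

lemma sum_inverse_sqrt_le: "(\<Sum>j<J. 1 / sqrt (real (Suc j))) \<le> 2 * sqrt (real J)"
proof (induction J)
  case (Suc J)
  define x y where "x = sqrt (real J)" and "y = sqrt (real (Suc J))"
  have "x \<ge> 0" "y > 0" "x ^ 2 = real J" "y ^ 2 = real J + 1"
    by (auto simp: x_def y_def)
  \<comment> \<open>With y^2 = x^2 + 1 this square equals 2y^2 - 2xy - 1.\<close>
  moreover have "0 \<le> (y - x) ^ 2" by simp
  ultimately have "1 \<le> (2 * y - 2 * x) * y"
    by (simp add: power2_eq_square algebra_simps)
  hence "1 / y \<le> 2 * y - 2 * x" using \<open>y > 0\<close> by (simp add: divide_le_eq)
  thus ?case using Suc by (simp add: x_def y_def)
qed auto

text \<open>Entries 1 may make these sums grow, but a square root bound reproduces itself: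
  sqrt(j+1)/(j+1) sums to at most 2 sqrt(J), so each entry costs one factor 2.\<close>

lemma strict_sum_le:
  assumes "0 \<notin> set ks" and m_ge: "\<And>j. m j \<ge> Suc j"
  shows   "strict_sum m ks J \<le> 2 ^ length ks * sqrt (real (Suc J))"
  using assms(1)
proof (induction ks arbitrary: J)
  case (Cons k ks)
  have "strict_sum m ks j / real (m j) ^ k \<le> 2 ^ length ks * (1 / sqrt (real (Suc j)))" for j
  proof -
    have "real (Suc j) ^ 1 \<le> real (m j) ^ 1" using m_ge[of j] by simp
    also have "\<dots> \<le> real (m j) ^ k"
      using Cons.prems m_ge[of j] by (intro power_increasing) auto
    finally have "strict_sum m ks j / real (m j) ^ k \<le>
        (2 ^ length ks * sqrt (real (Suc j))) / real (Suc j)"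
      using Cons by (intro frac_le) (auto simp: strict_sum_nonneg)
    also have "\<dots> = 2 ^ length ks * (1 / sqrt (real (Suc j)))"
    proof -
      have "sqrt x / x = 1 / sqrt x" if "x > 0" for x using that by (simp add: field_simps)
      thus ?thesis by (simp flip: times_divide_eq_right del: of_nat_Suc)
    qed
    finally show ?thesis .
  qed
  hence "strict_sum m (k # ks) J \<le> (\<Sum>j<J. 2 ^ length ks * (1 / sqrt (real (Suc j))))"
    by (simp del: of_nat_Suc add: sum_mono)
  also have "\<dots> \<le> 2 ^ length ks * (2 * sqrt (real J))"
    unfolding sum_distrib_left[symmetric] using sum_inverse_sqrt_le by (intro mult_left_mono) auto
  also have "\<dots> \<le> 2 ^ length (k # ks) * sqrt (real (Suc J))"
    by simp
  finally show ?case .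
qed auto

text \<open>The square root growth of the inner sum against a head exponent at least 2 leaves
  (j+1)^(-3/2).\<close>

lemma summable_head_sum:
  assumes "k \<ge> 2" "0 \<notin> set ks" and m_ge: "\<And>j. m j \<ge> Suc j"
  shows   "summable (head_sum m (k # ks))"
proof (rule summable_comparison_test')
  have "summable (\<lambda>j. 2 ^ length ks * real (Suc j) powr (-3 / 2))"
    by (intro summable_mult) (subst summable_Suc_iff[of "\<lambda>j. real j powr (-3 / 2)"],
        simp add: summable_real_powr_iff)
  thus "summable (\<lambda>j. 2 ^ length ks * real (Suc j) powr (-3 / 2))" .
  fix j :: nat
  have "real (Suc j) ^ 2 \<le> real (m j) ^ 2"
    using m_ge[of j] by (intro power_mono) auto
  also have "\<dots> \<le> real (m j) ^ k"
    using assms(1) m_ge[of j] by (intro power_increasing) auto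
  finally have "strict_sum m ks j / real (m j) ^ k \<le>
      (2 ^ length ks * sqrt (real (Suc j))) / real (Suc j) ^ 2"
    using assms strict_sum_le[of ks m j] by (intro frac_le) (auto simp: strict_sum_nonneg)
  also have "\<dots> = 2 ^ length ks * real (Suc j) powr (-3 / 2)"
  proof -
    have "sqrt x / x ^ 2 = x powr (-3 / 2)" if "x > 0" for x
    proof -
      have "x powr (-3 / 2) = x powr (1 / 2 - 2)" by simp
      also have "\<dots> = x powr (1 / 2) / x powr 2" by (rule powr_diff)
      also have "\<dots> = sqrt x / x ^ 2" using that by (simp add: powr_half_sqrt powr_numeral)
      finally show ?thesis ..
    qed
    thus ?thesis by (simp flip: times_divide_eq_right del: of_nat_Suc)
  qed
  finally show "norm (head_sum m (k # ks) j) \<le> 2 ^ length ks * real (Suc j) powr (-3 / 2)"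
    by (simp add: head_sum_def strict_sum_nonneg del: of_nat_Suc)
qed

lemma sums_sum_list:
  "(\<And>x. x \<in> set xs \<Longrightarrow> f x sums g x) \<Longrightarrow>
     (\<lambda>n. \<Sum>x\<leftarrow>xs. f x n :: 'b :: real_normed_vector) sums (\<Sum>x\<leftarrow>xs. g x)"
  by (induction xs) (auto intro!: sums_add)

lemma coeff_sum_list:
  "Polynomial.coeff (\<Sum>x\<leftarrow>xs. f x) d = (\<Sum>x\<leftarrow>xs. Polynomial.coeff (f x) d)"
  by (induction xs) auto

section \<open>Multiple t-values as series over the largest variable\<close>

definition mtv_term :: "nat list \<Rightarrow> nat list \<Rightarrow> real" where
  "mtv_term ks ms = 1 / prod_list (map2 (\<lambda>m k. real m ^ k) ms ks)"

lemma mtv_term_nonneg: "mtv_term ks ms \<ge> 0"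
  by (auto simp: mtv_term_def intro!: prod_list_nonneg)

context
  fixes N a :: nat and m :: "nat \<Rightarrow> nat"
  assumes N: "N > 0" and a: "a \<in> {1..N}" and m_def: "m = (\<lambda>j. a + j * N)"
begin

lemma m_less_iff: "m i < m j \<longleftrightarrow> i < j"
  using N by (simp add: m_def)

lemma m_ge_Suc: "m j \<ge> Suc j"
proof -
  have "j \<le> j * N" using N by simp
  moreover have "a \<ge> 1" using a by simp
  ultimately show ?thesis unfolding m_def by linarith
qed

lemma range_m: "range m = {x. x > 0 \<and> [x = a] (mod N)}"
proof (intro Set.set_eqI iffI)
  fix x assume "x \<in> {x. x > 0 \<and> [x = a] (mod N)}"
  hence x: "x > 0" "[x = a] (mod N)" by auto
  have "x \<ge> a"
  proof (rule ccontr)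
    assume "\<not> x \<ge> a"
    hence "x < N" "x < a" using a by auto
    \<comment> \<open>Below N, x is its own nonzero residue; a has residue 0 if a = N and residue a
      > x otherwise.\<close>
    thus False using x a by (cases "a = N") (auto simp: cong_def)
  qed
  then obtain j where "x = a + j * N"
    using x(2) by (metis cong_le_nat cong_sym add.commute)
  thus "x \<in> range m" by (auto simp: m_def)
qed (use a in \<open>auto simp: m_def cong_def\<close>)

definition bounded_range :: "nat \<Rightarrow> nat \<Rightarrow> nat list set" where
  "bounded_range n J = {ms \<in> mtv_range N a n. \<forall>x\<in>set ms. x < m J}"

lemma mtv_range_0: "mtv_range N a 0 = {[]}"
  by (auto simp: mtv_range_def)

text \<open>Splits off the largest variable. The set \<open>A\<close> is kept general:
  \<open>{..<J}\<close> serves the truncated sums, \<open>UNIV\<close> the full value.\<close>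

lemma bij_betw_mtv_range_Suc:
  "bij_betw (\<lambda>(j, ms). m j # ms) (Sigma A (bounded_range n))
     {ms \<in> mtv_range N a (Suc n). hd ms \<in> m ` A}"
proof (rule bij_betw_imageI)
  have "inj m" using m_less_iff by (intro linorder_injI) (metis less_irrefl)
  thus "inj_on (\<lambda>(j, ms). m j # ms) (Sigma A (bounded_range n))"
    by (auto simp: inj_on_def)
  have m: "m j > 0 \<and> [m j = a] (mod N)" for j using range_m by blast
  show "(\<lambda>(j, ms). m j # ms) ` Sigma A (bounded_range n) =
      {ms \<in> mtv_range N a (Suc n). hd ms \<in> m ` A}"
  proof (intro Set.set_eqI iffI)
    fix ms assume "ms \<in> {ms \<in> mtv_range N a (Suc n). hd ms \<in> m ` A}"
    then obtain j ms' where "ms = m j # ms'" "j \<in> A" "ms' \<in> bounded_range n j"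
      by (cases ms) (auto simp: mtv_range_def bounded_range_def)
    thus "ms \<in> (\<lambda>(j, ms). m j # ms) ` Sigma A (bounded_range n)" by force
  qed (use m in \<open>auto simp: mtv_range_def bounded_range_def\<close>)
qed

text \<open>Summation first over the smaller variables and then over the largest, legitimate because
  all terms are nonnegative.\<close>

lemma has_sum_mtv_term_Cons:
  assumes ks: "\<And>J. (mtv_term ks has_sum strict_sum m ks J) (bounded_range (length ks) J)"
      and S: "(head_sum m (k # ks) has_sum S) A"
  shows "(mtv_term (k # ks) has_sum S) {ms \<in> mtv_range N a (Suc (length ks)). hd ms \<in> m ` A}"
proof -
  define g where "g = (\<lambda>(j, ms). m j # ms)"
  have *: "((\<lambda>ms. mtv_term (k # ks) (g (j, ms))) has_sum head_sum m (k # ks) j)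
      (bounded_range (length ks) j)" for j
  proof -
    have "((\<lambda>ms. mtv_term ks ms / real (m j) ^ k) has_sum head_sum m (k # ks) j)
        (bounded_range (length ks) j)"
      using ks by (auto simp: head_sum_def intro!: has_sum_divide_const)
    thus ?thesis by (simp add: g_def mtv_term_def mult.commute)
  qed
  have "((\<lambda>x. mtv_term (k # ks) (g x)) has_sum S) (Sigma A (bounded_range (length ks)))"
  proof (rule has_sum_SigmaI)
    show "(\<lambda>x. mtv_term (k # ks) (g x)) summable_on Sigma A (bounded_range (length ks))"
      by (rule summable_on_SigmaI[OF *]) (use S in \<open>auto simp: mtv_term_nonneg summable_on_def\<close>)
  qed (use * S in auto)
  thus ?thesis
    using has_sum_reindex_bij_betw[OF bij_betw_mtv_range_Suc,
        where f = "mtv_term (k # ks)" and S = S and A1 = A]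
    by (simp add: g_def)
qed

lemma has_sum_strict_sum:
  "(mtv_term ks has_sum strict_sum m ks J) (bounded_range (length ks) J)"
proof (induction ks arbitrary: J)
  case Nil
  have "bounded_range 0 J = {[]}" by (auto simp: bounded_range_def mtv_range_0)
  thus ?case by (simp add: mtv_term_def has_sum_finite_iff)
next
  case (Cons k ks)
  \<comment> \<open>In a decreasing list all entries lie below \<open>m J\<close> exactly if the
    first one does.\<close>
  have "bounded_range (Suc n) J = {ms \<in> mtv_range N a (Suc n). hd ms \<in> m ` {..<J}}" for n
  proof (intro Set.set_eqI iffI)
    fix ms assume ms: "ms \<in> bounded_range (Suc n) J"
    then obtain x ms' where x: "ms = x # ms'" "x > 0" "[x = a] (mod N)" "x < m J"
      by (cases ms) (auto simp: bounded_range_def mtv_range_def)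
    then obtain j where "x = m j" using range_m by blast
    hence "x \<in> m ` {..<J}" using x m_less_iff by auto
    thus "ms \<in> {ms \<in> mtv_range N a (Suc n). hd ms \<in> m ` {..<J}}"
      using ms x by (auto simp: bounded_range_def)
  next
    fix ms assume ms: "ms \<in> {ms \<in> mtv_range N a (Suc n). hd ms \<in> m ` {..<J}}"
    then obtain j ms' where j: "ms = m j # ms'" "j < J"
      by (cases ms) (auto simp: mtv_range_def)
    hence "m j < m J" using m_less_iff by simp
    thus "ms \<in> bounded_range (Suc n) J"
      using ms j by (auto simp: bounded_range_def mtv_range_def)
  qed
  moreover have "(head_sum m (k # ks) has_sum strict_sum m (k # ks) J) {..<J}"
    by (simp add: has_sum_finite_iff strict_sum_eq_sum_head del: strict_sum.simps)
  ultimately show ?case using has_sum_mtv_term_Cons[OF Cons.IH] by simp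
qed

text \<open>Regroups the unordered sum defining the t-value by its largest variable; nonnegativity
  lets the ordered series be read as an unordered sum.\<close>

lemma head_sum_sums_mtv:
  assumes "p \<noteq> []" "hd p > 1" "0 \<notin> set p"
  shows   "head_sum m p sums mtv N a p"
proof -
  obtain k ks where p: "p = k # ks" using assms(1) by (cases p) auto
  have sm: "summable (head_sum m p)"
    using assms m_ge_Suc unfolding p by (intro summable_head_sum) auto
  define S where "S = suminf (head_sum m p)"
  have S: "head_sum m p sums S" using sm by (simp add: S_def summable_sums)
  moreover have "head_sum m p j \<ge> 0" for j by (simp add: head_sum_def strict_sum_nonneg)
  ultimately have "(head_sum m p has_sum S) UNIV" by (rule sums_nonneg_imp_has_sum)
  hence "(mtv_term p has_sum S) {ms \<in> mtv_range N a (length p). hd ms \<in> range m}"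
    using has_sum_mtv_term_Cons[OF has_sum_strict_sum] by (simp add: p)
  also have "{ms \<in> mtv_range N a (length p). hd ms \<in> range m} = mtv_range N a (length p)"
    unfolding range_m by (auto simp: mtv_range_def p length_Suc_conv)
  finally have "mtv N a p = S"
    unfolding mtv_def mtv_term_def by (rule infsumI)
  thus ?thesis using S by simp
qed

lemma interp_head_sums_interp_mtv:
  assumes "ks \<noteq> []" "hd ks > 1" "0 \<notin> set ks"
  shows   "(\<lambda>J. Polynomial.coeff (interp_head m ks J) d) sums
             Polynomial.coeff (interp_mtv N a ks) d"
  unfolding interp_head_def interp_mtv_def coeff_sum_list coeff_monom
proof (rule sums_sum_list)
  fix p assume p: "p \<in> set (box_choices ks)"
  have "head_sum m p sums mtv N a p"
    using p assms box_choices_length[of ks p] box_choices_hd_ge[of ks p] box_choices_pos[of ks p]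
    by (intro head_sum_sums_mtv) auto
  thus "(\<lambda>J. if length ks - length p = d then head_sum m p J else 0) sums
          (if length ks - length p = d then mtv N a p else 0)"
    by auto
qed

end

lemma X0_series_eq: "X0_series N a = admissible_series (interp_mtv N a)"
proof (rule series_eqI)
  fix i j l
  define B where "B = {(k :: nat, n :: nat, s :: nat). k \<ge> n + s \<and> n \<ge> s \<and> s \<ge> 1 \<and>
                       k - n - s = i \<and> n - s = j \<and> 2 * s - 2 = l}"
  have coeff: "ser_coeff (X0_series N a) i j l = (\<Sum>(k, n, s)\<in>B. X0 N a k n s)"
    by (simp add: X0_series_def B_def)
  show "ser_coeff (X0_series N a) i j l = ser_coeff (admissible_series (interp_mtv N a)) i j l"
  proof (cases "even l")
    case True
    then obtain h where h: "l = 2 * h" by (elim evenE)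
    \<comment> \<open>The exponents determine s = h + 1, then n = j + s and k = i + n + s; s >= 1
      makes \<open>2 * s - 2\<close> exact.\<close>
    have "B = {(i + j + 2 * Suc h, j + Suc h, Suc h)}"
      unfolding B_def h by auto
    thus ?thesis
      unfolding coeff by (simp add: admissible_series_def h admissible_lists_eq_I0 X0_def)
  next
    case False
    have "B = {}"
    proof -
      have "even l" if "2 * s - 2 = l" for s :: nat
        using that by (metis dvd_diff_nat dvd_refl dvd_triv_left)
      thus ?thesis using False by (auto simp: B_def)
    qed
    thus ?thesis using False by (simp add: coeff admissible_series_def)
  qed
qed

text \<open>A coefficient of a product is a finite combination of coefficients of the factors, so a
  fixed factor passes through a coefficientwise sum.\<close>

lemma coeff_ser_coeff_mult_sums:
  assumes "\<And>i j l d. (\<lambda>n. Polynomial.coeff (ser_coeff (T n) i j l) d) sums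
                         Polynomial.coeff (ser_coeff S i j l) d"
  shows   "(\<lambda>n. Polynomial.coeff (ser_coeff (F * T n) i j l) d) sums
             Polynomial.coeff (ser_coeff (F * S) i j l) d"
  unfolding ser_coeff_mult coeff_sum coeff_mult
  by (intro sums_sum sums_mult assms)

subsection \<open>Hypergeometric terms\<close>

lemma emb_simps [simp]:
  "emb 1 = 1" "emb (F + G) = emb F + emb G" "emb (F - G) = emb F - emb G"
  "emb (- F) = - emb F" "emb (F * G) = emb F * emb G"
  "emb F = 0 \<longleftrightarrow> F = 0"
  by (simp_all add: emb_def)

lemma emb_of_nat [simp]: "emb (of_nat n) = of_nat n"
  by (induction n) (auto simp: emb_def)

lemma emb_power [simp]: "emb (F ^ n) = emb F ^ n"
  by (induction n) auto

lemma emb_alpha_poly: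
  assumes "\<alpha>1 + \<alpha>2 = emb (ser_u + ser_v * ser_r)"
      and "\<alpha>1 * \<alpha>2 = emb (ser_r * (ser_u * ser_v - ser_w ^ 2))"
  shows   "emb (alpha_poly n) = (of_nat n - \<alpha>1) * (of_nat n - \<alpha>2)"
proof -
  have "emb (alpha_poly n) = of_nat n ^ 2 - of_nat n * (\<alpha>1 + \<alpha>2) + \<alpha>1 * \<alpha>2"
    unfolding assms alpha_poly_def by (simp only: emb_simps emb_of_nat emb_power)
  also have "\<dots> = (of_nat n - \<alpha>1) * (of_nat n - \<alpha>2)"
    by (simp add: algebra_simps power2_eq_square)
  finally show ?thesis .
qed

lemma emb_beta_poly:
  assumes "\<beta>1 + \<beta>2 = emb (- ser_u + ser_v * (1 - ser_r))"
      and "\<beta>1 * \<beta>2 = emb ((ser_r - 1) * (ser_u * ser_v - ser_w ^ 2))"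
  shows   "emb (beta_poly n) = (of_nat n + \<beta>1) * (of_nat n + \<beta>2)"
proof -
  have "emb (beta_poly n) = of_nat n ^ 2 + of_nat n * (\<beta>1 + \<beta>2) + \<beta>1 * \<beta>2"
    unfolding assms beta_poly_def by (simp only: emb_simps emb_of_nat emb_power)
  also have "\<dots> = (of_nat n + \<beta>1) * (of_nat n + \<beta>2)"
    by (simp add: algebra_simps power2_eq_square)
  finally show ?thesis .
qed

text \<open>The constant term is n^2. Hence the hypergeometric denominators and Q(a) are invertible
  in the closure.\<close>

lemma alpha_poly_nonzero:
  assumes "n > 0"
  shows   "alpha_poly n \<noteq> 0"
proof -
  have "ser_coeff (alpha_poly n) 0 0 0 = ser_coeff (of_nat n ^ 2 * 1) 0 0 0"
    by (simp add: alpha_poly_def ser_coeff_def ser_u_def ser_v_def ser_w_def)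
  also have "\<dots> \<noteq> 0"
    using assms by (simp only: of_nat_power[symmetric] ser_coeff_of_nat_mult) simp
  finally show ?thesis by auto
qed

text \<open>The upper parameter 1 contributes n + 1, which cancels against the ratio of
  factorials.\<close>

lemma hypergeo_3F2_rec:
  fixes b1 b2 c1 c2 :: "'a :: field_char_0"
  shows "fps_nth (fps_hypergeo [b1, b2, 1] [c1, c2] 1) (Suc n) =
           (b1 + of_nat n) * (b2 + of_nat n) / ((c1 + of_nat n) * (c2 + of_nat n)) *
           fps_nth (fps_hypergeo [b1, b2, 1] [c1, c2] 1) n"
proof -
  have "of_nat (Suc n) \<noteq> (0 :: 'a)" using of_nat_neq_0 by blast
  thus ?thesis
    unfolding fps_hypergeo_rec
    by (simp add: mult_ac del: fps_hypergeo_nth of_nat_Suc flip: of_nat_Suc)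
qed

theorem theorem2p1:
  fixes N a :: nat and \<alpha>1 \<alpha>2 \<beta>1 \<beta>2 :: series_closure
  assumes "N > 0" and "a \<in> {1..N}"
    and "\<alpha>1 + \<alpha>2 = emb (ser_u + ser_v * ser_r)"
    and "\<alpha>1 * \<alpha>2 = emb (ser_r * (ser_u * ser_v - ser_w ^ 2))"
    and "\<beta>1 + \<beta>2 = emb (- ser_u + ser_v * (1 - ser_r))"
    and "\<beta>1 * \<beta>2 = emb ((ser_r - 1) * (ser_u * ser_v - ser_w ^ 2))"
  shows "\<exists>H. has_3F2_value
                ((of_nat a + \<beta>1) / of_nat N) ((of_nat a + \<beta>2) / of_nat N) 1
                ((of_nat a - \<alpha>1) / of_nat N + 1) ((of_nat a - \<alpha>2) / of_nat N + 1) 1 H \<and>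
             emb (X0_series N a) = 1 / ((of_nat a - \<alpha>1) * (of_nat a - \<alpha>2)) * emb H"
proof -
  define m where "m = (\<lambda>j. a + j * N)"
  define S where "S = (\<lambda>J. admissible_head_series m J)"
  define b1 b2 where "b1 = (of_nat a + \<beta>1) / of_nat N" and "b2 = (of_nat a + \<beta>2) / of_nat N"
  define c1 c2 where "c1 = (of_nat a - \<alpha>1) / of_nat N + 1"
    and "c2 = (of_nat a - \<alpha>2) / of_nat N + 1"
  note alpha = emb_alpha_poly[OF assms(3,4)] and beta = emb_beta_poly[OF assms(5,6)]
  have m_pos: "m j > 0" for j using assms(2) by (simp add: m_def)
  have N: "of_nat N \<noteq> (0 :: series_closure)" using assms(1) by simp

  \<comment> \<open>Both sides start at 1 and obey the same first-order recursion, so the J-th term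
    is Q(a) S_J.\<close>
  have terms: "fps_nth (fps_hypergeo [b1, b2, 1] [c1, c2] 1) J = emb (alpha_poly a * S J)" for J
  proof (induction J)
    case 0
    have "alpha_poly a * S 0 = 1"
      using admissible_head_series_0[of m] m_pos by (simp add: S_def m_def)
    thus ?case by (simp only: fps_hypergeo_0 emb_simps)
  next
    case (Suc J)
    define M where "M = (of_nat (m J) :: series_closure)"
    define A1 A2 where "A1 = of_nat (m (Suc J)) - \<alpha>1" and "A2 = of_nat (m (Suc J)) - \<alpha>2"
    have b: "b1 + of_nat J = (M + \<beta>1) / of_nat N" "b2 + of_nat J = (M + \<beta>2) / of_nat N"
      using N by (simp_all add: M_def b1_def b2_def m_def field_simps)
    \<comment> \<open>The summand 1 in the lower parameters turns \<open>m J\<close> into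
      \<open>m (Suc J)\<close>; the powers of N cancel in the quotient of \<open>b\<close> and
      \<open>c\<close>.\<close>
    have c: "c1 + of_nat J = A1 / of_nat N" "c2 + of_nat J = A2 / of_nat N"
      using N by (simp_all add: A1_def A2_def c1_def c2_def m_def field_simps)
    have A: "A1 * A2 = emb (alpha_poly (m (Suc J)))"
      by (simp add: alpha A1_def A2_def)
    hence nz: "A1 * A2 \<noteq> 0" using alpha_poly_nonzero[OF m_pos] by simp
    have rec: "A1 * A2 * emb (S (Suc J)) = (M + \<beta>1) * (M + \<beta>2) * emb (S J)"
    proof -
      have "emb (alpha_poly (m (Suc J)) * S (Suc J)) = emb (beta_poly (m J) * S J)"
        using admissible_head_series_Suc[of m] m_pos by (simp only: S_def)
      thus ?thesis by (simp only: emb_simps A beta M_def)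
    qed
    have "fps_nth (fps_hypergeo [b1, b2, 1] [c1, c2] 1) (Suc J) =
        (M + \<beta>1) * (M + \<beta>2) / (A1 * A2) * emb (alpha_poly a * S J)"
      unfolding hypergeo_3F2_rec Suc b c using N by simp
    also have "\<dots> = emb (alpha_poly a) * ((M + \<beta>1) * (M + \<beta>2) * emb (S J)) / (A1 * A2)"
      by simp
    also have "\<dots> = emb (alpha_poly a * S (Suc J))"
      unfolding rec[symmetric] using nz by simp
    finally show ?case .
  qed

  have sums: "(\<lambda>J. Polynomial.coeff (ser_coeff (S J) i j l) d) sums
      Polynomial.coeff (ser_coeff (X0_series N a) i j l) d" for i j l d
  proof (cases "even l")
    case True
    have "(\<lambda>J. \<Sum>ks\<in>admissible_lists i j (Suc (l div 2)). Polynomial.coeff (interp_head m ks J) d) sums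
        (\<Sum>ks\<in>admissible_lists i j (Suc (l div 2)). Polynomial.coeff (interp_mtv N a ks) d)"
      by (intro sums_sum interp_head_sums_interp_mtv[OF assms(1,2) m_def])
         (auto simp: admissible_lists_def positive_lists_def)
    thus ?thesis
      using True m_pos
      by (simp add: S_def admissible_head_series_def X0_series_eq admissible_series_def coeff_sum)
  next
    case False
    thus ?thesis
      using m_pos
      by (simp add: S_def admissible_head_series_def X0_series_eq admissible_series_def)
  qed

  \<comment> \<open>The witness H is Q(a) times the left-hand side: the S_J sum to the latter, and
    Q(a) S_J are the hypergeometric terms.\<close>
  have "has_3F2_value b1 b2 1 c1 c2 1 (alpha_poly a * X0_series N a)"
    unfolding has_3F2_value_def sums_coeffwise_def
    by (intro exI[of _ "\<lambda>J. alpha_poly a * S J"] conjI allI terms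
              coeff_ser_coeff_mult_sums sums)
  moreover have "emb (X0_series N a) =
      1 / ((of_nat a - \<alpha>1) * (of_nat a - \<alpha>2)) * emb (alpha_poly a * X0_series N a)"
    using alpha_poly_nonzero[of a] assms(2) by (simp flip: alpha)
  ultimately show ?thesis unfolding b1_def b2_def c1_def c2_def by blast
qed

end
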